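(* Let $\mathcal{A},\mathcal{B}$ be sets, $\mathcal{C}\subset\mathbb{R}$, and let $s_{y|x}:\mathbb{R}^D\to\mathbb{R}$ be continuously differentiable for all $x\in\mathcal{B}$, $y\in\mathcal{A}$. Assume that $\ell:\mathbb{R}\times\mathcal{C}\to\mathbb{R}$ is twice continuously differentiable in its first variable, that $\mathcal{R}:\mathbb{R}^D\to\mathbb{R}$ is twice continuously differentiable, that $\mathcal{C}$ has a maximum, and that $\partial_s\ell(s,\max\mathcal{C})<0$ for all $s\in\mathbb{R}$. Let $\mathbf{D}$ be a dataset, $\theta^*\in\mathbb{R}^D$ and $(x,y,z)\in\mathcal{B}\times\mathcal{A}\times\mathcal{A}$. If $\nabla\mathrm{Loss}(\theta^*|\mathbf{D})=0$, $\nabla^2\mathrm{Loss}(\theta^*|\mathbf{D})\succ 0$ and $\nabla s_{zy|x}(\theta^* )\neq 0$, then $\mathrm{Loss}$ is locally pairwise monotone at $\mathbf{D}$ and $\theta^*$ for the addition of the unequivocal comparison $(x,y,z,\max\mathcal{C})$; that is, there exist a neighborhood $\mathcal{U}$ of $\theta^*$ and $\varepsilon_0>0$ such that for all $0\le\varepsilon\le\varepsilon_0$ and all $$\theta^\varepsilon\in\operatorname*{arg\,min}_{\theta\in\mathcal{U}}\Big[\mathrm{Loss}(\theta|\mathbf{D})+\varepsilon\,\ell\big(s_{yz|x}(\theta),\max\mathcal{C}\big)\Big],$$ one has $s_{yz|x}(\theta^\varepsilon)\ge s_{yz|x}(\theta^* )$.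
   Context: $\mathcal{A}$ is a set of alternatives, $\mathcal{B}$ a set of backgrounds, $\mathcal{C}\subset\mathbb{R}$ a set of possible comparison values. A dataset $\mathbf{D}$ is a finite multiset of elements $(x,y,z,c)\in\mathcal{B}\times\mathcal{A}\times\mathcal{A}\times\mathcal{C}$. For a parametrized score $s_{y|x}(\theta)\in\mathbb{R}$ ($\theta\in\mathbb{R}^D$), write $s_{yz|x}(\theta)=s_{y|x}(\theta)-s_{z|x}(\theta)$. The loss is $$\mathrm{Loss}(\theta|\mathbf{D})=\mathcal{R}(\theta)+\sum_{(x,y,z,c)\in\mathbf{D}}\ell(s_{yz|x}(\theta),c),$$ with $\mathcal{R}:\mathbb{R}^D\to\mathbb{R}$ a (possibly zero) regularization and $\ell:\mathbb{R}\times\mathcal{C}\to\mathbb{R}$; $\partial_s\ell$ is the derivative of $\ell$ in its first variable. $\nabla,\nabla^2$ denote gradient and Hessian in $\theta$ (the Hessian hypothesis includes that $\mathrm{Loss}(\cdot|\mathbf{D})$ is twice differentiable at $\theta^*$), and $\succ 0$ means positive definite. Adding $(x,y,z,\max\mathcal{C})$ to $\mathbf{D}$ with weight $\varepsilon$ means replacing $\mathrm{Loss}(\theta|\mathbf{D})$ by $\mathrm{Loss}(\theta|\mathbf{D})+\varepsilon\,\ell(s_{yz|x}(\theta),\max\mathcal{C})$. *)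

theory Defs
  imports "HOL-Analysis.Analysis" "HOL-Library.Multiset"
begin

definition C1_fun :: "('a::real_normed_vector \<Rightarrow> 'b::real_normed_vector) \<Rightarrow> bool" where
  "C1_fun f \<longleftrightarrow>
     (\<exists>f' :: 'a \<Rightarrow> 'a \<Rightarrow>\<^sub>L 'b. (\<forall>x. (f has_derivative blinfun_apply (f' x)) (at x)) \<and> continuous_on UNIV f')"

definition C2_fun :: "('a::real_normed_vector \<Rightarrow> 'b::real_normed_vector) \<Rightarrow> bool" where
  "C2_fun f \<longleftrightarrow>
     (\<exists>f' :: 'a \<Rightarrow> 'a \<Rightarrow>\<^sub>L 'b. (\<forall>x. (f has_derivative blinfun_apply (f' x)) (at x)) \<and> C1_fun f')"

text \<open>Twice differentiability at the single point \<open>x\<close>: the gradient exists near \<open>x\<close> and is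
  Frechet differentiable at \<open>x\<close>, with Jacobian matrix \<open>H\<close>.\<close>

definition has_hessian :: "(real ^ 'd \<Rightarrow> real) \<Rightarrow> real ^ 'd ^ 'd \<Rightarrow> real ^ 'd \<Rightarrow> bool" where
  "has_hessian f H x \<longleftrightarrow>
     (\<exists>g. (\<forall>\<^sub>F u in nhds x. GDERIV f u :> g u) \<and> (g has_derivative (\<lambda>h. H *v h)) (at x))"

text \<open>Symmetry is not required here; a matrix \<open>H\<close> with \<open>has_hessian f H x\<close> is symmetric anyway,
  by Schwarz's theorem.\<close>

definition positive_definite :: "real ^ 'd ^ 'd \<Rightarrow> bool" where
  "positive_definite H \<longleftrightarrow> (\<forall>v. v \<noteq> 0 \<longrightarrow> v \<bullet> (H *v v) > 0)"

text \<open>\<open>s x y \<theta>\<close> is the score $s_{y|x}(\theta)$ of alternative \<open>y\<close> against background \<open>x\<close>.\<close>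

definition score_diff :: "('b \<Rightarrow> 'a \<Rightarrow> real ^ 'd \<Rightarrow> real) \<Rightarrow> 'b \<Rightarrow> 'a \<Rightarrow> 'a \<Rightarrow> real ^ 'd \<Rightarrow> real" where
  "score_diff s x y z \<theta> = s x y \<theta> - s x z \<theta>"

definition loss ::
  "(real ^ 'd \<Rightarrow> real) \<Rightarrow> (real \<Rightarrow> real \<Rightarrow> real) \<Rightarrow> ('b \<Rightarrow> 'a \<Rightarrow> real ^ 'd \<Rightarrow> real) \<Rightarrow>
   ('b \<times> 'a \<times> 'a \<times> real) multiset \<Rightarrow> real ^ 'd \<Rightarrow> real" where
  "loss R l s D \<theta> = R \<theta> + (\<Sum>(x, y, z, c)\<in>#D. l (score_diff s x y z \<theta>) c)"

definition locally_pairwise_monotone ::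
  "(real ^ 'd \<Rightarrow> real) \<Rightarrow> (real \<Rightarrow> real \<Rightarrow> real) \<Rightarrow> ('b \<Rightarrow> 'a \<Rightarrow> real ^ 'd \<Rightarrow> real) \<Rightarrow>
   ('b \<times> 'a \<times> 'a \<times> real) multiset \<Rightarrow> real ^ 'd \<Rightarrow> 'b \<times> 'a \<times> 'a \<times> real \<Rightarrow> bool" where
  "locally_pairwise_monotone R l s D \<theta>s = (\<lambda>(x, y, z, c).
     \<exists>U \<epsilon>0. \<theta>s \<in> interior U \<and> \<epsilon>0 > 0 \<and>
       (\<forall>\<epsilon> \<theta>\<epsilon>. 0 \<le> \<epsilon> \<longrightarrow> \<epsilon> \<le> \<epsilon>0 \<longrightarrow>
          is_arg_min (\<lambda>\<theta>. loss R l s D \<theta> + \<epsilon> * l (score_diff s x y z \<theta>) c) (\<lambda>\<theta>. \<theta> \<in> U) \<theta>\<epsilon> \<longrightarrow>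
          score_diff s x y z \<theta>\<epsilon> \<ge> score_diff s x y z \<theta>s))"

end

theory Submission imports Defs begin

text \<open>Gradient zero and positive definite Hessian make \<open>\<theta>s\<close> the strict minimizer of the unperturbed loss
  on some ball. At a point of the ball with smaller score difference than at \<open>\<theta>s\<close>, the unperturbed
  loss is strictly larger, and so is the comparison loss, which is strictly decreasing in the score
  difference; hence such a point does not minimize the perturbed loss, whatever the weight
  \<open>\<epsilon> \<ge> 0\<close>. In particular any \<open>\<epsilon>0\<close> works.\<close>

text \<open>The quadratic form is continuous, so it attains its minimum on the compact unit sphere.
  That minimum is positive, and homogeneity of degree two carries it to all vectors as
  \<open>m\<close>.\<close>

lemma positive_definite_coercive:
  fixes H :: "real ^ 'd ^ 'd"
  assumes "positive_definite H"
  obtains m where "m > 0" "\<And>v. m * (norm v)\<^sup>2 \<le> v \<bullet> (H *v v)"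
proof -
  let ?S = "sphere (0 :: real ^ 'd) 1"
  have "continuous_on ?S (\<lambda>v. v \<bullet> (H *v v))"
    by (intro continuous_intros linear_continuous_on matrix_vector_mul_bounded_linear)
  moreover have "compact ?S" "?S \<noteq> {}" by auto
  ultimately obtain w where w: "w \<in> ?S" "\<And>v. v \<in> ?S \<Longrightarrow> w \<bullet> (H *v w) \<le> v \<bullet> (H *v v)"
    using continuous_attains_inf by metis
  show thesis
  proof
    show "w \<bullet> (H *v w) > 0"
      using assms w(1) unfolding positive_definite_def by (metis norm_zero mem_sphere_0 zero_neq_one)
    fix v :: "real ^ 'd"
    show "w \<bullet> (H *v w) * (norm v)\<^sup>2 \<le> v \<bullet> (H *v v)"
    proof (cases "v = 0")
      case False
      define u where "u = inverse (norm v) *\<^sub>R v"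
      have v: "v = norm v *\<^sub>R u" and "u \<in> ?S"
        using False by (simp_all add: u_def)
      have "v \<bullet> (H *v v) = (norm v *\<^sub>R u) \<bullet> (H *v (norm v *\<^sub>R u))"
        using v by simp
      also have "\<dots> = (norm v)\<^sup>2 * (u \<bullet> (H *v u))"
        by (simp add: matrix_vector_mult_scaleR power2_eq_square)
      finally show ?thesis
        using w(2)[OF \<open>u \<in> ?S\<close>] by (simp add: mult.commute mult_right_mono)
    qed simp
  qed
qed

text \<open>The Hessian is available only at \<open>x\<close> itself, so the argument uses
  first-order information along segments: the gradient near \<open>x\<close> has a positive
  component in the outward radial direction, and the mean value theorem turns this into growth of
  \<open>f\<close>.\<close>

lemma second_derivative_test_strict_min:
  fixes f :: "real ^ 'd \<Rightarrow> real"
  assumes critical: "GDERIV f x :> 0"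
    and hessian: "has_hessian f H x" "positive_definite H"
  obtains r where "r > 0" "\<And>u. u \<in> ball x r \<Longrightarrow> u \<noteq> x \<Longrightarrow> f x < f u"
proof -
  obtain g where ev: "\<forall>\<^sub>F u in nhds x. GDERIV f u :> g u"
    and gH: "(g has_derivative (\<lambda>h. H *v h)) (at x)"
    using hessian(1) by (auto simp: has_hessian_def)
  \<comment> \<open>\<open>g\<close> is merely some gradient field supplied by
    \<open>has_hessian\<close>; uniqueness of the derivative identifies its value at
    \<open>x\<close> with 0.\<close>
  have "GDERIV f x :> g x"
    using ev by (rule eventually_nhds_x_imp_x)
  then have "(\<lambda>h. h \<bullet> g x) = (\<lambda>h. h \<bullet> 0)"
    using critical has_derivative_unique unfolding gderiv_def by blast
  then have "g x \<bullet> g x = g x \<bullet> 0" by (rule fun_cong)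
  then have gx: "g x = 0" by simp
  obtain r1 where r1: "r1 > 0" "\<And>u. dist u x < r1 \<Longrightarrow> GDERIV f u :> g u"
    using ev by (auto simp: eventually_nhds_metric)
  obtain m where m: "m > 0" "\<And>v. m * (norm v)\<^sup>2 \<le> v \<bullet> (H *v v)"
    using positive_definite_coercive[OF hessian(2)] by blast
  \<comment> \<open>With tolerance \<open>m / 2\<close>, the linearization error uses up at most
    half of the coercive term \<open>m * (norm (u - x))\<^sup>2\<close>.\<close>
  obtain r2 where r2: "r2 > 0"
    "\<And>u. norm (u - x) < r2 \<Longrightarrow> norm (g u - g x - H *v (u - x)) \<le> m / 2 * norm (u - x)"
    using gH m(1) unfolding has_derivative_at_alt by (meson half_gt_zero)
  have radial: "(u - x) \<bullet> g u > 0" if u: "norm (u - x) < r2" "u \<noteq> x" for u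
  proof -
    let ?h = "u - x"
    have "\<bar>?h \<bullet> (g u - H *v ?h)\<bar> \<le> norm ?h * norm (g u - H *v ?h)"
      by (rule Cauchy_Schwarz_ineq2)
    also have "\<dots> \<le> norm ?h * (m / 2 * norm ?h)"
      using r2(2)[OF u(1)] gx by (intro mult_left_mono) auto
    also have "\<dots> = m * (norm ?h)\<^sup>2 / 2"
      by (simp add: power2_eq_square)
    finally have "\<bar>?h \<bullet> g u - ?h \<bullet> (H *v ?h)\<bar> \<le> m * (norm ?h)\<^sup>2 / 2"
      by (simp add: inner_diff_right)
    moreover have "m * (norm ?h)\<^sup>2 > 0"
      using m(1) u(2) by simp
    ultimately show ?thesis
      using m(2)[of ?h] by linarith
  qed
  show thesis
  proof
    show "min r1 r2 > 0" using r1 r2 by simp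
    fix u assume u: "u \<in> ball x (min r1 r2)" "u \<noteq> x"
    let ?p = "\<lambda>t::real. x + t *\<^sub>R (u - x)"
    have near: "norm (?p t - x) < min r1 r2" if "0 \<le> t" "t \<le> 1" for t
    proof -
      have "norm (?p t - x) \<le> norm (u - x)"
        using that by (simp add: mult_left_le_one_le)
      then show ?thesis using u(1) by (simp add: dist_norm norm_minus_commute)
    qed
    have "((\<lambda>t. f (?p t)) has_real_derivative (u - x) \<bullet> g (?p t)) (at t)"
      if t: "0 \<le> t" "t \<le> 1" for t
    proof -
      have "(f has_derivative (\<lambda>h. h \<bullet> g (?p t))) (at (?p t))"
        using r1(2)[of "?p t"] near[OF t] by (simp add: gderiv_def dist_norm)
      moreover have "(?p has_derivative (\<lambda>h. h *\<^sub>R (u - x))) (at t)"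
        by (auto intro!: derivative_eq_intros)
      ultimately have "((\<lambda>t. f (?p t)) has_derivative (\<lambda>h. (h *\<^sub>R (u - x)) \<bullet> g (?p t))) (at t)"
        by (rule has_derivative_compose[rotated])
      then show ?thesis
        by (simp add: has_field_derivative_def mult_commute_abs)
    qed
    then have "\<exists>t>0. t < 1 \<and> f (?p 1) - f (?p 0) = (1 - 0) * ((u - x) \<bullet> g (?p t))"
      by (rule MVT2[OF zero_less_one])
    then obtain t where t: "0 < t" "t < 1" and diff: "f u - f x = (u - x) \<bullet> g (?p t)"
      by auto
    \<comment> \<open>At the intermediate point the outward direction is \<open>t\<close> times
      \<open>u - x\<close> with \<open>t > 0\<close>, so \<open>radial\<close> fixes the sign of the
      slope along the segment.\<close>
    have "0 < (?p t - x) \<bullet> g (?p t)"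
      using near[of t] t u(2) by (intro radial) auto
    also have "(?p t - x) \<bullet> g (?p t) = t * ((u - x) \<bullet> g (?p t))"
      by simp
    finally show "f x < f u"
      using t(1) diff by (simp add: zero_less_mult_iff)
  qed
qed

text \<open>\<open>deriv\<close> is a total function, so a sign condition on it yields monotonicity
  only once it is known to be a true derivative.\<close>

lemma C2_fun_has_real_derivative_deriv:
  fixes f :: "real \<Rightarrow> real"
  assumes "C2_fun f"
  shows "(f has_real_derivative deriv f t) (at t)"
proof -
  have "f differentiable (at t)"
    using assms by (auto simp: C2_fun_def differentiable_def)
  then show ?thesis
    by (simp add: DERIV_deriv_iff_real_differentiable)
qed

theorem theorem1:
  fixes A :: "'a set" and B :: "'b set" and C :: "real set" and cmax :: real
    and s :: "'b \<Rightarrow> 'a \<Rightarrow> real ^ 'd \<Rightarrow> real"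
    and l :: "real \<Rightarrow> real \<Rightarrow> real"
    and R :: "real ^ 'd \<Rightarrow> real"
    and D :: "('b \<times> 'a \<times> 'a \<times> real) multiset"
    and \<theta>s G :: "real ^ 'd" and H :: "real ^ 'd ^ 'd"
    and x :: 'b and y z :: 'a
  assumes s_C1: "\<And>x y. x \<in> B \<Longrightarrow> y \<in> A \<Longrightarrow> C1_fun (s x y)"
    and l_C2: "\<And>c. c \<in> C \<Longrightarrow> C2_fun (\<lambda>t. l t c)"
    and R_C2: "C2_fun R"
    and cmax: "cmax \<in> C" "\<And>c. c \<in> C \<Longrightarrow> c \<le> cmax"
    and l_decreasing: "\<And>t. deriv (\<lambda>u. l u cmax) t < 0"
    and D: "set_mset D \<subseteq> B \<times> A \<times> A \<times> C"
    and xyz: "x \<in> B" "y \<in> A" "z \<in> A"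
    and critical: "GDERIV (loss R l s D) \<theta>s :> 0"
    and hessian: "has_hessian (loss R l s D) H \<theta>s" "positive_definite H"
    and score_gradient: "GDERIV (score_diff s x z y) \<theta>s :> G" "G \<noteq> 0"
  shows "locally_pairwise_monotone R l s D \<theta>s (x, y, z, cmax)"
proof -
  obtain r where r: "r > 0"
    "\<And>u. u \<in> ball \<theta>s r \<Longrightarrow> u \<noteq> \<theta>s \<Longrightarrow> loss R l s D \<theta>s < loss R l s D u"
    using second_derivative_test_strict_min[OF critical hessian] by blast
  have l_anti: "l b cmax < l a cmax" if "a < b" for a b
    using that C2_fun_has_real_derivative_deriv[OF l_C2[OF cmax(1)]] l_decreasing
    by (intro DERIV_neg_imp_decreasing[of a b "\<lambda>t. l t cmax"]) blast+
  let ?d = "score_diff s x y z"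
  have "?d \<theta>s \<le> ?d u"
    if \<epsilon>: "0 \<le> \<epsilon>"
      and min: "is_arg_min (\<lambda>\<theta>. loss R l s D \<theta> + \<epsilon> * l (?d \<theta>) cmax) (\<lambda>\<theta>. \<theta> \<in> ball \<theta>s r) u" for \<epsilon> u
  proof (rule ccontr)
    assume "\<not> ?d \<theta>s \<le> ?d u"
    then have less: "?d u < ?d \<theta>s" by simp
    have u: "u \<in> ball \<theta>s r"
      and le: "loss R l s D u + \<epsilon> * l (?d u) cmax \<le> loss R l s D \<theta>s + \<epsilon> * l (?d \<theta>s) cmax"
      using min r(1) unfolding is_arg_min_linorder by auto
    \<comment> \<open>The strict inequality \<open>less\<close> excludes
      \<open>u = \<theta>s\<close>, so strict minimality applies.\<close>
    have "loss R l s D \<theta>s < loss R l s D u"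
      using r(2)[OF u] less by blast
    \<comment> \<open>Only a weak inequality holds here, since \<epsilon> may be 0; the strictness
      of the contradiction comes from the unperturbed loss.\<close>
    moreover have "\<epsilon> * l (?d \<theta>s) cmax \<le> \<epsilon> * l (?d u) cmax"
      using l_anti[OF less] \<epsilon> by (intro mult_left_mono) auto
    ultimately show False using le by linarith
  qed
  moreover have "\<theta>s \<in> interior (ball \<theta>s r)" using r(1) by simp
  ultimately show ?thesis
    unfolding locally_pairwise_monotone_def split_conv
    by (intro exI[of _ "ball \<theta>s r"] exI[of _ "1::real"]) simp
qed

end
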